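(* Let $n = pq$ be a non-square semiprime, where $p<q$ are the prime factors of $n$. Define $$\omega = \left\lfloor \frac{(n^{2n} + 1)^{2n+1} \bmod (n^{4n}-n)}{(n^{2n} + 1)^{2n} \bmod (n^{4n}-n)} \right\rfloor - 1 ,$$ $$\gamma = \left\lfloor \frac{(\omega+1)^{\omega(\omega+2)}}{\left\lfloor \dfrac{\left( (\omega+1)^{\omega(\omega+2)} + 1 \right)^{(\omega+1)^{\omega+2}}}{(\omega+1)^{\omega^2(\omega+2)}} \right\rfloor \bmod (\omega+1)^{\omega(\omega+2)}} \right\rfloor .$$ Then $$q = \frac{n}{\left\lfloor \dfrac{n^{n+n(\gamma \bmod n)}}{(n^n-1)(n^{\gamma \bmod n}-1)} \right\rfloor \bmod n} .$$
   Context: A semiprime is a product of exactly two primes; it is non-square if the two primes are distinct. $\lfloor\cdot\rfloor$ is the floor of a rational number. For an integer $u$ and a positive integer $m$, $u \bmod m$ denotes the least non-negative remainder, $u \bmod m = u - m\lfloor u/m\rfloor$. In the definition of $\gamma$, the outer denominator is the quantity (inner floor) $\bmod\ (\omega+1)^{\omega(\omega+2)}$; in the formula for $q$, the outer denominator is the quantity (floor) $\bmod\ n$. *)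

theory Defs
  imports Complex_Main "HOL-Computational_Algebra.Primes"
begin

text \<open>
  All quantities are integers, quotients are taken in the rationals, and \<open>mod\<close> on \<open>int\<close> with a
  positive modulus is the least non-negative remainder. Integer exponents are converted by
  \<open>nat\<close>; they are all non-negative once \<open>w \<ge> 0\<close>.
\<close>

definition omega :: "nat \<Rightarrow> int" where
  "omega n =
    \<lfloor>rat_of_int ((int n ^ (2 * n) + 1) ^ (2 * n + 1) mod (int n ^ (4 * n) - int n)) /
     rat_of_int ((int n ^ (2 * n) + 1) ^ (2 * n) mod (int n ^ (4 * n) - int n))\<rfloor> - 1"

definition gamma_of :: "int \<Rightarrow> int" where
  "gamma_of w =
    \<lfloor>rat_of_int ((w + 1) ^ nat (w * (w + 2))) /
     rat_of_int
       (\<lfloor>rat_of_int (((w + 1) ^ nat (w * (w + 2)) + 1) ^ nat ((w + 1) ^ nat (w + 2))) /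
         rat_of_int ((w + 1) ^ nat (w ^ 2 * (w + 2)))\<rfloor>
        mod (w + 1) ^ nat (w * (w + 2)))\<rfloor>"

definition gamma :: "nat \<Rightarrow> int" where
  "gamma n = gamma_of (omega n)"

end

theory Submission imports Defs "HOL-Number_Theory.Cong" begin

text \<open>
  The three nested formulas compute \<open>\<lfloor>sqrt n\<rfloor>\<close>, then a factorial, then a greatest common divisor,
  and the proof evaluates them one by one.

  Modulo \<open>x ^ 2 - n\<close> with \<open>x = n ^ (2 * n)\<close>, the number \<open>x\<close> acts as a square root of \<open>n\<close>, so that
  \<open>(x + 1) ^ k\<close> has a remainder \<open>a * x + b\<close>, where \<open>b + a * sqrt n = (1 + sqrt n) ^ k\<close>. The number
  \<open>x\<close> exceeds the coefficients for \<open>k = 2 * n\<close> and \<open>k = 2 * n + 1\<close> by far, so the quotient of the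
  two remainders is close to \<open>(a + b) / a = 1 + b / a\<close>, and \<open>b / a\<close> is an excellent approximation
  of \<open>sqrt n\<close>. Hence \<open>omega n = \<lfloor>sqrt n\<rfloor>\<close> (\<open>omega_eq_floor_sqrt\<close>).

  Write \<open>m\<close> for this value, \<open>r = (m + 1) ^ (m + 2)\<close> and \<open>B = r ^ m\<close>. The digits of \<open>(B + 1) ^ r\<close> to
  the base \<open>B\<close> in positions up to \<open>m\<close> are binomial coefficients, so the inner quotient is
  \<open>r choose m\<close>. As \<open>r\<close> is huge, \<open>r ^ m / (r choose m)\<close> is only slightly larger than \<open>fact m\<close>.
  Hence \<open>gamma n = fact m\<close> (\<open>gamma_of_eq_fact\<close>).

  Because \<open>p \<le> \<lfloor>sqrt n\<rfloor> < q\<close>, the factorial is divisible by \<open>p\<close> and not by \<open>q\<close>; its remainder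
  \<open>g\<close> modulo \<open>n\<close> therefore satisfies \<open>gcd n g = p\<close>. Finally, expanding
  \<open>n ^ (n + n * g) / ((n ^ n - 1) * (n ^ g - 1))\<close> as a product of two geometric series in \<open>1 / n\<close>,
  the coefficient of \<open>n ^ 0\<close> counts the \<open>i\<close> in \<open>{1..g}\<close> with \<open>g dvd n * i\<close>. There are \<open>gcd n g\<close> of
  them, and the remaining terms contribute multiples of \<open>n\<close> and a fractional part below 1
  (\<open>gcd_as_digit\<close>).
\<close>

section \<open>The greatest common divisor as a digit\<close>

text \<open>
  The number \<open>g\<close> divides \<open>n * i\<close> exactly if \<open>i\<close> is a multiple of \<open>g div gcd n g\<close>.
\<close>

lemma card_multiples_eq_gcd:
  fixes n g :: nat
  assumes "g > 0"
  shows "card {i \<in> {1..g}. g dvd n * i} = gcd n g"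
proof -
  define d where "d = gcd n g"
  define h where "h = g div d"
  have d: "d > 0" using assms by (simp add: d_def)
  have g: "g = h * d" by (simp add: h_def d_def)
  then have h: "h > 0" using assms by (cases h) auto
  have iff: "g dvd n * i \<longleftrightarrow> h dvd i" for i
  proof -
    define m where "m = n div d"
    have n: "n = m * d" by (simp add: m_def d_def)
    have "coprime m h"
      unfolding m_def h_def d_def using assms by (intro div_gcd_coprime) auto
    then have "h dvd m * i \<longleftrightarrow> h dvd i"
      by (simp add: coprime_commute coprime_dvd_mult_right_iff)
    moreover have "g dvd n * i \<longleftrightarrow> h dvd m * i"
      using d by (simp add: n g mult.assoc mult.left_commute[of _ d] mult.commute[of _ d])
    ultimately show ?thesis by simp
  qed
  have "{i \<in> {1..g}. g dvd n * i} = (\<lambda>k. h * k) ` {1..d}"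
  proof (intro equalityI subsetI)
    fix i assume "i \<in> {i \<in> {1..g}. g dvd n * i}"
    then have i: "1 \<le> i" "i \<le> g" "h dvd i" using iff by auto
    then obtain k where k: "i = h * k" by blast
    have "h * k \<le> h * d" using i g k by simp
    with h have "k \<le> d" by simp
    moreover have "k \<ge> 1" using i k by (cases k) auto
    ultimately have "k \<in> {1..d}" by simp
    with k show "i \<in> (\<lambda>k. h * k) ` {1..d}" by blast
  next
    fix i assume "i \<in> (\<lambda>k. h * k) ` {1..d}"
    then obtain k where k: "i = h * k" "1 \<le> k" "k \<le> d" by (elim imageE) auto
    have "h * k \<le> g" using k g by simp
    moreover have "1 \<le> h * k" using k h by (simp add: Suc_le_eq)
    ultimately show "i \<in> {i \<in> {1..g}. g dvd n * i}" using k iff by simp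
  qed
  moreover have "inj_on (\<lambda>k. h * k) {1..d}" using h by (simp add: inj_on_def)
  ultimately show ?thesis by (simp add: card_image d_def)
qed

text \<open>
  Division of a power of \<open>y\<close> by \<open>y ^ g - 1\<close>: the quotient \<open>Q\<close> is the sum of the powers
  \<open>y ^ (m - g * j)\<close> with \<open>1 \<le> j \<le> m div g\<close>. All of them except \<open>y ^ 0\<close> are divisible by \<open>y\<close>, and \<open>y ^ 0\<close>
  occurs exactly if \<open>g\<close> divides \<open>m\<close>.
\<close>

lemma power_divide_by_power_minus_one:
  fixes y :: int and g m :: nat
  defines "Q \<equiv> y ^ (m mod g) * (\<Sum>k<m div g. (y ^ g) ^ k)"
  assumes "g > 0" and "m > 0"
  shows "y ^ m = y ^ (m mod g) + (y ^ g - 1) * Q"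
    and "[Q = (if g dvd m then 1 else 0)] (mod y)"
proof -
  have "y ^ m = y ^ (m mod g) * (y ^ g) ^ (m div g)"
    by (simp flip: power_mult power_add)
  also have "(y ^ g) ^ (m div g) = 1 + (y ^ g - 1) * (\<Sum>k<m div g. (y ^ g) ^ k)"
    using power_diff_1_eq[of "y ^ g" "m div g"] by linarith
  finally show "y ^ m = y ^ (m mod g) + (y ^ g - 1) * Q"
    unfolding Q_def by (simp only: distrib_left mult_1_right mult.left_commute)
  show "[Q = (if g dvd m then 1 else 0)] (mod y)"
  proof (cases "g dvd m")
    case True
    then obtain t where t: "m div g = Suc t"
      using assms by (cases "m div g") (auto simp: dvd_div_eq_0_iff)
    have "(\<Sum>k<m div g. (y ^ g) ^ k) = 1 + y ^ g * (\<Sum>k<t. (y ^ g) ^ k)"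
      unfolding t by (simp add: sum.lessThan_Suc_shift sum_distrib_left del: sum.lessThan_Suc)
    moreover have "y dvd y ^ g" using \<open>g > 0\<close> by simp
    ultimately show ?thesis
      using True by (simp add: Q_def cong_iff_dvd_diff)
  next
    case False
    then have "y dvd y ^ (m mod g)" by (simp add: mod_greater_zero_iff_not_dvd)
    with False show ?thesis by (simp add: Q_def cong_0_iff)
  qed
qed

text \<open>
  By the geometric series, \<open>n ^ (n + n * g)\<close> is \<open>n ^ n\<close> plus the product of \<open>n ^ n - 1\<close> with the sum
  of the powers \<open>n ^ (n * i)\<close> for \<open>1 \<le> i \<le> g\<close>. Dividing each of these by \<open>n ^ g - 1\<close> yields a
  quotient that is 1 or 0 modulo \<open>n\<close>, according to whether \<open>g\<close> divides \<open>n * i\<close>.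
\<close>

lemma gcd_as_digit:
  fixes n g :: nat
  assumes "2 \<le> g" and "g < n"
  shows "int n ^ (n + n * g) div ((int n ^ n - 1) * (int n ^ g - 1)) mod int n = int (gcd n g)"
proof -
  define y where "y = int n"
  define X where "X = y ^ n - 1"
  define G where "G = y ^ g - 1"
  define Q where "Q i = y ^ (n * i mod g) * (\<Sum>k<n * i div g. (y ^ g) ^ k)" for i
  define R where "R = (\<Sum>i\<in>{1..g}. y ^ (n * i mod g))"
  have y: "y \<ge> 3" using assms by (simp add: y_def)
  have pw: "y ^ k \<ge> 3" if "k \<ge> 1" for k
    using power_increasing[of 1 k y] that y by simp
  have G: "G > 0" and X: "X > 1" using pw[of g] pw[of n] assms by (auto simp: G_def X_def)
  have Q: "y ^ (n * i) = y ^ (n * i mod g) + G * Q i"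
    and Qc: "[Q i = (if g dvd n * i then 1 else 0)] (mod y)" if "i \<in> {1..g}" for i
    using power_divide_by_power_minus_one[of g "n * i" y] assms that
    by (auto simp: G_def Q_def)
  have "y ^ (n * g) - 1 = X * (\<Sum>i<g. (y ^ n) ^ i)"
    unfolding X_def power_mult by (rule power_diff_1_eq)
  then have "y ^ (n + n * g) = X * (\<Sum>i<g. y ^ n * (y ^ n) ^ i) + y ^ n"
    by (simp add: power_add sum_distrib_left[symmetric] algebra_simps)
  also have "(\<Sum>i<g. y ^ n * (y ^ n) ^ i) = (\<Sum>i\<in>{1..g}. y ^ (n * i))"
    by (rule sum.reindex_bij_witness[of _ "\<lambda>i. i - 1" Suc])
       (auto simp: power_add simp flip: power_mult)
  also have "\<dots> = (\<Sum>i\<in>{1..g}. y ^ (n * i mod g) + G * Q i)"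
    using Q by (intro sum.cong) auto
  also have "\<dots> = R + G * (\<Sum>i\<in>{1..g}. Q i)"
    by (simp add: R_def sum.distrib sum_distrib_left)
  finally have N: "y ^ (n + n * g) = (X * G) * (\<Sum>i\<in>{1..g}. Q i) + (X * (R + 1) + 1)"
    by (simp add: X_def algebra_simps)
  \<comment> \<open>What has been left over must stay below the divisor \<open>X * G\<close>. The crude estimate of each
    of the \<open>g < y\<close> summands of \<open>R\<close> by \<open>y ^ (g - 1)\<close> is enough.\<close>
  have "R \<le> (\<Sum>i\<in>{1..g}. y ^ (g - 1))"
    unfolding R_def
  proof (intro sum_mono power_increasing)
    fix i
    have "n * i mod g < g" using assms by simp
    then show "n * i mod g \<le> g - 1" by linarith
  qed (use y in auto)
  also have "\<dots> = int g * y ^ (g - 1)" by simp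
  also have "\<dots> \<le> (y - 1) * y ^ (g - 1)"
    using assms y by (intro mult_right_mono) (auto simp: y_def)
  also have "\<dots> = G + 1 - y ^ (g - 1)"
    using assms by (simp add: G_def algebra_simps power_eq_if)
  finally have R: "R \<le> G - 2" using pw[of "g - 1"] assms by linarith
  have R0: "R \<ge> 0" unfolding R_def using y by (intro sum_nonneg) auto
  have "X * (R + 1) \<le> X * (G - 1)" using R X by (intro mult_left_mono) auto
  then have lt: "X * (R + 1) + 1 < X * G" using X by (simp add: algebra_simps)
  have ge: "0 \<le> X * (R + 1) + 1" using X R0 by simp
  have "y ^ (n + n * g) div (X * G) = (\<Sum>i\<in>{1..g}. Q i)"
    unfolding N using lt ge X G by (simp add: div_mult_self4 div_pos_pos_trivial)
  moreover have "[(\<Sum>i\<in>{1..g}. Q i) = (\<Sum>i\<in>{1..g}. if g dvd n * i then 1 else 0)] (mod y)"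
    using Qc by (intro cong_sum) auto
  moreover have "(\<Sum>i\<in>{1..g}. if g dvd n * i then 1 else 0) = int (gcd n g)"
  proof -
    have "(\<Sum>i\<in>{1..g}. if g dvd n * i then 1 else 0)
        = (\<Sum>i\<in>{i \<in> {1..g}. g dvd n * i}. 1::int)"
      by (rule sum.inter_filter[symmetric]) simp
    then show ?thesis using card_multiples_eq_gcd[of g n] assms by simp
  qed
  moreover have "gcd n g < n"
    using assms gcd_le2_nat[of g n] by linarith
  ultimately show ?thesis
    by (simp add: cong_def y_def X_def G_def)
qed

section \<open>The factorial as a quotient of powers and binomial coefficients\<close>

lemma sum_digits_less_power:
  fixes c :: "nat \<Rightarrow> nat"
  assumes "\<And>j. j < m \<Longrightarrow> c j < B"
  shows "(\<Sum>j<m. c j * B ^ j) < B ^ m"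
  using assms
proof (induction m)
  case (Suc m)
  have "(\<Sum>j<m. c j * B ^ j) < B ^ m" using Suc by simp
  moreover have "(c m + 1) * B ^ m \<le> B * B ^ m"
    using Suc.prems[of m] by (intro mult_right_mono) auto
  ultimately show ?case by simp
qed simp

text \<open>
  In the binomial expansion of \<open>(B + 1) ^ r\<close> the terms below position \<open>m\<close> add up to less than
  \<open>B ^ m\<close>, and those above are divisible by \<open>B ^ (m + 1)\<close>. The latter coefficients may exceed \<open>B\<close>.
\<close>

lemma binomial_as_digit:
  fixes B r m :: nat
  assumes small: "\<And>j. j \<le> m \<Longrightarrow> r choose j < B"
  shows "(B + 1) ^ r div B ^ m mod B = r choose m"
proof -
  define L where "L = (\<Sum>j<m. (r choose j) * B ^ j)"
  have B: "B > 0" using small[of m] by simp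
  have "(B + 1) ^ r = (\<Sum>j\<le>r. (r choose j) * B ^ j)"
    using binomial[of B 1 r] by simp
  \<comment> \<open>Padding with zero terms puts \<open>m\<close> into the range of summation even if \<open>m > r\<close>.\<close>
  also have "\<dots> = (\<Sum>j\<le>r + m. (r choose j) * B ^ j)"
    by (rule sum.mono_neutral_left) (auto simp: binomial_eq_0)
  also have "\<dots> = (\<Sum>j\<in>{..<m} \<union> {m} \<union> {m<..r + m}. (r choose j) * B ^ j)"
    by (intro sum.cong) auto
  also have "\<dots> = L + (r choose m) * B ^ m + (\<Sum>j\<in>{m<..r + m}. (r choose j) * B ^ j)"
    unfolding L_def by (subst sum.union_disjoint, simp, simp, force)+ simp
  finally have sum: "(B + 1) ^ r = \<dots>" .
  have "B ^ (m + 1) dvd (\<Sum>j\<in>{m<..r + m}. (r choose j) * B ^ j)"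
    by (intro dvd_sum dvd_mult le_imp_power_dvd) auto
  then obtain H where "(\<Sum>j\<in>{m<..r + m}. (r choose j) * B ^ j) = B ^ (m + 1) * H" by blast
  with sum have "(B + 1) ^ r = L + B ^ m * ((r choose m) + B * H)"
    by (simp add: algebra_simps)
  moreover have "L < B ^ m" unfolding L_def using small by (intro sum_digits_less_power) auto
  ultimately have "(B + 1) ^ r div B ^ m = (r choose m) + B * H" using B by simp
  then show ?thesis using small[of m] by simp
qed

lemma falling_factorial_ge:
  fixes r m :: nat
  assumes "m \<le> r"
  shows "(real r - real m) ^ m \<le> fact m * real (r choose m)"
proof -
  have "(real r - real m) ^ m = (\<Prod>i=0..<m. real r - real m)" by simp
  also have "\<dots> \<le> (\<Prod>i=0..<m. real r - real i)"
    using assms by (intro prod_mono) auto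
  also have "\<dots> = fact m * real (r choose m)"
    by (simp add: gbinomial_mult_fact binomial_gbinomial)
  finally show ?thesis .
qed

text \<open>
  The quotient of \<open>r ^ m\<close> by the falling factorial \<open>fact m * (r choose m)\<close> is at least 1, and
  Bernoulli's inequality bounds it by \<open>1 / (1 - m ^ 2 / r)\<close>. The hypothesis on \<open>r\<close> is what makes the
  excess, once multiplied by \<open>fact m\<close>, smaller than 1.
\<close>

lemma power_div_binomial_eq_fact:
  fixes r m :: nat
  assumes large: "(fact m + 1) * m ^ 2 < r" and "m > 0"
  shows "r ^ m div (r choose m) = fact m"
proof -
  have "m * 1 \<le> m * m" using \<open>m > 0\<close> by (intro mult_left_mono) auto
  also have "\<dots> \<le> (fact m + 1) * m ^ 2" by (simp add: power2_eq_square)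
  finally have "m < r" using large by simp
  then have r: "real r > 0" "real m / real r \<le> 1" and C: "r choose m > 0" by auto
  have lower: "(r choose m) * fact m \<le> r ^ m" by (rule binomial_fact_pow)
  have "1 + real m * (- (real m / real r)) \<le> (1 + - (real m / real r)) ^ m"
    using r by (intro Bernoulli_inequality) simp
  then have "real r ^ m * (1 - real m ^ 2 / real r) \<le> real r ^ m * (1 - real m / real r) ^ m"
    by (intro mult_left_mono) (auto simp: power2_eq_square)
  also have "\<dots> = (real r - real m) ^ m"
    using r by (simp add: field_simps flip: power_mult_distrib)
  also have "\<dots> \<le> fact m * real (r choose m)"
    using \<open>m < r\<close> by (intro falling_factorial_ge) simp
  finally have ff: "real r ^ m * (1 - real m ^ 2 / real r) \<le> fact m * real (r choose m)" .
  have "real ((fact m + 1) * m ^ 2) < real r" using large by (simp only: of_nat_less_iff)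
  then have "(fact m + 1) * real m ^ 2 / real r < 1"
    using r by (simp add: field_simps)
  then have "fact m < (fact m + 1) * (1 - real m ^ 2 / real r)"
    by (simp add: algebra_simps)
  then have "real r ^ m * fact m < real r ^ m * ((fact m + 1) * (1 - real m ^ 2 / real r))"
    using r by (intro mult_strict_left_mono) auto
  also have "\<dots> = (fact m + 1) * (real r ^ m * (1 - real m ^ 2 / real r))" by simp
  also have "\<dots> \<le> (fact m + 1) * (fact m * real (r choose m))"
    by (intro mult_left_mono ff) simp
  also have "\<dots> = fact m * ((fact m + 1) * real (r choose m))" by simp
  finally have "fact m * real r ^ m < fact m * ((fact m + 1) * real (r choose m))"
    by (simp only: mult.commute)
  then have "real r ^ m < (fact m + 1) * real (r choose m)"
    by (rule mult_left_less_imp_less) simp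
  also have "\<dots> = real ((fact m + 1) * (r choose m))"
    by (simp only: of_nat_mult of_nat_add of_nat_fact of_nat_1)
  finally have upper: "r ^ m < (fact m + 1) * (r choose m)"
    by (simp only: of_nat_less_iff flip: of_nat_power)
  show ?thesis
    by (rule div_nat_eqI) (use lower upper in \<open>simp_all add: mult.commute\<close>)
qed

text \<open>
  For \<open>m = 1\<close> the formula breaks down: then \<open>r choose m\<close> equals the base \<open>r ^ m\<close>
  and is lost in the reduction. From \<open>m = 2\<close> on, \<open>(r choose m) * fact m \<le> r ^ m\<close> keeps it below
  the base.
\<close>

lemma gamma_of_eq_fact:
  assumes "m \<ge> 2"
  shows "gamma_of (int m) = fact m"
proof -
  define r where "r = (m + 1) ^ (m + 2)"
  define B where "B = r ^ m"
  have r1: "r > 1" unfolding r_def using assms by (intro one_less_power) auto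
  have "fact m \<le> m ^ m" using fact_le_power[of m, where 'a = nat] by simp
  also have "\<dots> < (m + 1) ^ m" using assms by (intro power_strict_mono) auto
  finally have F: "fact m + 1 \<le> (m + 1) ^ m" by simp
  have "(fact m + 1) * m ^ 2 < (m + 1) ^ m * (m + 1) ^ 2"
    using F by (intro mult_le_less_imp_less power_strict_mono) auto
  then have large: "(fact m + 1) * m ^ 2 < r" by (simp only: r_def power_add)
  have "r choose j < B" if j: "j \<le> m" for j
  proof (cases "j = m")
    case True
    have "m \<le> fact m" by (rule fact_ge_self)
    then have "(r choose m) * 2 \<le> (r choose m) * fact m" using assms by (intro mult_left_mono) auto
    also have "\<dots> \<le> B" unfolding B_def by (rule binomial_fact_pow)
    finally have "(r choose m) * 2 \<le> B" .
    moreover have "B > 0" using r1 by (simp add: B_def)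
    ultimately have "r choose m < B" by linarith
    with True show ?thesis by simp
  next
    case False
    have "r choose j \<le> r ^ j" 
      using binomial_fact_pow[of r j] le_trans[of "r choose j" "(r choose j) * fact j"] by simp
    also have "r ^ j < B" unfolding B_def using False j r1 by (intro power_strict_increasing) auto
    finally show ?thesis .
  qed
  then have dig: "(B + 1) ^ r div B ^ m mod B = r choose m" by (rule binomial_as_digit)
  have e1: "nat (int m * (int m + 2)) = (m + 2) * m"
    by (simp add: nat_mult_distrib nat_add_distrib)
  have e2: "nat ((int m) ^ 2 * (int m + 2)) = (m + 2) * m * m"
    by (simp add: nat_mult_distrib nat_add_distrib nat_power_eq power2_eq_square algebra_simps)
  have e3: "nat ((int m + 1) ^ nat (int m + 2)) = r"
  proof -
    have "nat (int m + 2) = m + 2" by simp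
    moreover have "(int m + 1) ^ (m + 2) = int r"
      by (simp only: r_def of_nat_power of_nat_add of_nat_1)
    ultimately show ?thesis by (simp only: nat_int)
  qed
  have b1: "(int m + 1) ^ ((m + 2) * m) = int B"
    by (simp only: B_def r_def power_mult of_nat_power of_nat_add of_nat_1)
  have b2: "(int m + 1) ^ ((m + 2) * m * m) = int (B ^ m)"
    by (simp only: B_def r_def power_mult of_nat_power of_nat_add of_nat_1)
  have "gamma_of (int m) = int B div ((int B + 1) ^ r div int (B ^ m) mod int B)"
    unfolding gamma_of_def e1 e2 e3 b1 b2 floor_divide_of_int_eq ..
  also have "\<dots> = int (B div ((B + 1) ^ r div B ^ m mod B))"
    by (simp add: zdiv_int zmod_int add.commute)
  also have "\<dots> = int (fact m)"
    unfolding dig unfolding B_def using power_div_binomial_eq_fact[OF large] assms by simp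
  finally show ?thesis by simp
qed

section \<open>The integer square root from powers modulo a quadratic\<close>

text \<open>
  The coefficients of \<open>(1 + sqrt n) ^ k\<close> over the integers. Since \<open>x ^ 2\<close> is congruent to \<open>n\<close>, the same
  coefficients describe \<open>(x + 1) ^ k\<close>; conjugation gives the equation for \<open>1 - sqrt n\<close>. The last
  property is the growth bound obtained by replacing \<open>sqrt n\<close> with its upper bound \<open>s + 1\<close>.
\<close>

lemma quadratic_power_coefficients:
  fixes n s :: nat and x :: int
  assumes "n \<le> (s + 1) ^ 2"
  obtains a b :: nat where
    "[(x + 1) ^ k = int a * x + int b] (mod x ^ 2 - int n)"
    "real b + real a * sqrt n = (1 + sqrt n) ^ k"
    "real b - real a * sqrt n = (1 - sqrt n) ^ k"
    "a * (s + 1) + b \<le> (s + 2) ^ k"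
proof -
  have "\<exists>a b :: nat.
    [(x + 1) ^ k = int a * x + int b] (mod x ^ 2 - int n) \<and>
    real b + real a * sqrt n = (1 + sqrt n) ^ k \<and>
    real b - real a * sqrt n = (1 - sqrt n) ^ k \<and>
    a * (s + 1) + b \<le> (s + 2) ^ k"
  proof (induction k)
    case 0
    show ?case by (rule exI[of _ 0], rule exI[of _ 1]) simp
  next
    case (Suc k)
    then obtain a b :: nat where IH:
      "[(x + 1) ^ k = int a * x + int b] (mod x ^ 2 - int n)"
      "real b + real a * sqrt n = (1 + sqrt n) ^ k"
      "real b - real a * sqrt n = (1 - sqrt n) ^ k"
      "a * (s + 1) + b \<le> (s + 2) ^ k" by blast
    have sq: "sqrt n * sqrt n = real n" by simp
    have "[(x + 1) * (x + 1) ^ k = (x + 1) * (int a * x + int b)] (mod x ^ 2 - int n)"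
      using IH(1) by (rule cong_scalar_left)
    moreover have "[(x + 1) * (int a * x + int b) = int (a + b) * x + int (n * a + b)]
        (mod x ^ 2 - int n)"
    proof -
      have "(x + 1) * (int a * x + int b) - (int (a + b) * x + int (n * a + b))
          = (x ^ 2 - int n) * int a"
        by (simp add: algebra_simps power2_eq_square)
      then show ?thesis by (simp add: cong_iff_dvd_diff)
    qed
    ultimately have 1: "[(x + 1) ^ Suc k = int (a + b) * x + int (n * a + b)]
        (mod x ^ 2 - int n)"
      using cong_trans by simp
    have 2: "real (n * a + b) + real (a + b) * sqrt n = (1 + sqrt n) ^ Suc k"
      by (simp add: IH(2)[symmetric] algebra_simps sq)
    have 3: "real (n * a + b) - real (a + b) * sqrt n = (1 - sqrt n) ^ Suc k"
      by (simp add: IH(3)[symmetric] algebra_simps sq)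
    have "n * a \<le> (s + 1) ^ 2 * a" using assms by (rule mult_right_mono) simp
    then have "(a + b) * (s + 1) + (n * a + b) \<le> (s + 2) * (a * (s + 1) + b)"
      by (simp add: algebra_simps power2_eq_square)
    also have "\<dots> \<le> (s + 2) * (s + 2) ^ k" using IH(4) by (rule mult_left_mono) simp
    also have "\<dots> = (s + 2) ^ Suc k" by simp
    finally show ?case using 1 2 3 by blast
  qed
  then show ?thesis using that by blast
qed

text \<open>
  The fraction \<open>b / a\<close> exceeds \<open>sqrt n\<close> because the exponent is even. That it does not reach the next
  integer \<open>s + 1\<close> follows from the norm equation \<open>b ^ 2 - n * a ^ 2 = (n - 1) ^ (2 * n)\<close>: as
  \<open>n + 1 \<le> (s + 1) ^ 2\<close>, it suffices that \<open>a > (n - 1) ^ n\<close>, and this is where the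
  exponent \<open>2 * n\<close> is large enough.
\<close>

lemma convergent_between:
  fixes a b n s :: nat
  assumes "n \<ge> 2" and s: "s ^ 2 \<le> n" "n < (s + 1) ^ 2"
    and plus: "real b + real a * sqrt n = (1 + sqrt n) ^ (2 * n)"
    and minus: "real b - real a * sqrt n = (1 - sqrt n) ^ (2 * n)"
  shows "s * a \<le> b" and "b < (s + 1) * a"
proof -
  define t where "t = sqrt n"
  have t2: "t * t = real n" by (simp add: t_def)
  have t1: "t > 1" using assms(1) by (simp add: t_def)
  have st: "real s \<le> t" unfolding t_def using s(1)
    by (intro real_le_rsqrt) (simp flip: of_nat_power)
  have "0 \<le> (1 - t) ^ (2 * n)" by (simp add: power_mult)
  then have "real a * t \<le> real b" using minus unfolding t_def by linarith
  moreover have "real s * real a \<le> real a * t" using st by (subst mult.commute) (rule mult_left_mono, simp_all)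
  ultimately have "real (s * a) \<le> real b" by simp
  then show "s * a \<le> b" by linarith
  define c where "c = real (n - 1) ^ n"
  have norm: "(t + 1) * (t - 1) = real (n - 1)"
    using assms(1) by (simp add: algebra_simps t2 of_nat_diff)
  have c_alt: "c = (t + 1) ^ n * (t - 1) ^ n"
    by (simp only: c_def norm[symmetric] power_mult_distrib)
  have prod: "real b ^ 2 - real n * real a ^ 2 = c ^ 2"
  proof -
    have "real b ^ 2 - real n * real a ^ 2 = (real b + real a * t) * (real b - real a * t)"
      by (simp add: algebra_simps power2_eq_square flip: t2)
    also have "\<dots> = (1 + t) ^ (2 * n) * ((1 - t) ^ 2) ^ n"
      using plus minus by (simp add: t_def power_mult)
    also have "(1 - t) ^ 2 = (t - 1) ^ 2" by (simp add: power2_eq_square algebra_simps)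
    also have "(1 + t) ^ (2 * n) * ((t - 1) ^ 2) ^ n = c ^ 2"
      by (simp add: c_alt power_mult_distrib add.commute mult.commute flip: power_mult)
    finally show ?thesis .
  qed
  \<comment> \<open>By Bernoulli's inequality \<open>((t + 1) / (t - 1)) ^ n > 1 + 2 * t\<close>. Multiplied by \<open>c\<close>, this bounds
    \<open>(1 + t) ^ (2 * n)\<close> from below; subtracting the conjugate isolates \<open>2 * t * a\<close>.\<close>
  have "c < real a"
  proof -
    have u1: "(1 + 2 * t) * (t - 1) ^ n < (t + 1) ^ n"
    proof -
      have "2 * real n / (t - 1) > 2 * t"
        using t1 by (simp add: field_simps flip: t2)
      moreover have "1 + real n * (2 / (t - 1)) \<le> (1 + 2 / (t - 1)) ^ n"
        using t1 by (intro Bernoulli_inequality) (simp add: field_simps)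
      ultimately have "1 + 2 * t < (1 + 2 / (t - 1)) ^ n" by (simp add: mult.commute)
      also have "1 + 2 / (t - 1) = (t + 1) / (t - 1)" using t1 by (simp add: field_simps)
      finally show ?thesis using t1 by (simp add: power_divide field_simps)
    qed
    have "(1 + 2 * t) * c = ((1 + 2 * t) * (t - 1) ^ n) * (t + 1) ^ n"
      by (simp add: c_alt)
    also have "\<dots> < (t + 1) ^ n * (t + 1) ^ n"
      using u1 t1 by (intro mult_strict_right_mono) auto
    also have "\<dots> = (1 + t) ^ (2 * n)"
      by (simp add: mult_2 power_add add.commute)
    finally have "(1 + 2 * t) * c < (1 + t) ^ (2 * n)" .
    moreover have "(1 - t) ^ (2 * n) \<le> c"
    proof -
      have "(1 - t) ^ (2 * n) = (t - 1) ^ n * (t - 1) ^ n"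
        by (simp add: power_mult power2_eq_square algebra_simps flip: power_mult_distrib)
      also have "\<dots> \<le> (t + 1) ^ n * (t - 1) ^ n"
        using t1 by (intro mult_right_mono power_mono) auto
      finally show ?thesis by (simp add: c_alt)
    qed
    ultimately have "2 * t * c < 2 * t * real a"
      using plus minus by (simp add: t_def algebra_simps)
    then show ?thesis using t1 by simp
  qed
  then have "c ^ 2 < real a ^ 2" using c_def by (intro power_strict_mono) auto
  then have "real b ^ 2 < (real n + 1) * real a ^ 2" using prod by (simp add: algebra_simps)
  also have "\<dots> \<le> real ((s + 1) ^ 2) * real a ^ 2"
  proof (rule mult_right_mono)
    have "real (n + 1) \<le> real ((s + 1) ^ 2)" using s(2) by (simp only: of_nat_le_iff)
    then show "real n + 1 \<le> real ((s + 1) ^ 2)" by simp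
  qed simp
  also have "\<dots> = real ((s + 1) * a) ^ 2" by (simp only: of_nat_power of_nat_mult power_mult_distrib)
  finally have "real b < real ((s + 1) * a)" by (rule power_less_imp_less_base) simp
  then show "b < (s + 1) * a" by (simp only: of_nat_less_iff)
qed

text \<open>
  Since \<open>s + 2 \<le> 2 * s\<close>, the base satisfies \<open>(s + 2) ^ 2 \<le> 4 * n\<close>, which reduces the claim to
  \<open>n * 4 ^ n \<le> n ^ n\<close>. With the growth bound on the coefficients, this shows how far
  \<open>n ^ (2 * n)\<close> exceeds them.
\<close>

lemma power_bound:
  fixes n s :: nat
  assumes n: "n \<ge> 6" and s: "s ^ 2 \<le> n" "s \<ge> 2"
  shows "n * (s + 2) ^ (2 * n) \<le> n ^ (2 * n)"
proof -
  have exp: "n * 4 ^ n \<le> n ^ n"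
  proof -
    have "n * 2 ^ n \<le> 3 ^ n" using n
    proof (induction n rule: dec_induct)
      case (step k)
      have "Suc k * 2 ^ Suc k = k * 2 ^ k * 2 + 2 * 2 ^ k" by simp
      also have "\<dots> \<le> k * 2 ^ k * 3" using step(1) by (simp add: algebra_simps)
      also have "\<dots> \<le> 3 ^ Suc k" using step by simp
      finally show ?case .
    qed simp
    then have "n * 2 ^ n * 2 ^ n \<le> 3 ^ n * 2 ^ n" by (rule mult_right_mono) simp
    then have "n * 4 ^ n \<le> 6 ^ n" by (simp add: mult.assoc flip: power_mult_distrib)
    also have "\<dots> \<le> n ^ n" using n by (intro power_mono) auto
    finally show ?thesis .
  qed
  have "(s + 2) ^ 2 \<le> (2 * s) ^ 2" using s by (intro power_mono) auto
  also have "\<dots> \<le> 4 * n" using s by (simp add: power_mult_distrib)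
  finally have "((s + 2) ^ 2) ^ n \<le> (4 * n) ^ n" by (rule power_mono) simp
  then have "n * (s + 2) ^ (2 * n) \<le> n * (4 ^ n * n ^ n)"
    by (simp add: power_mult power_mult_distrib)
  also have "\<dots> \<le> n ^ n * n ^ n" using mult_right_mono[OF exp, of "n ^ n"] by (simp add: mult.assoc)
  also have "\<dots> = n ^ (2 * n)" by (simp add: mult_2 power_add)
  finally show ?thesis .
qed

text \<open>
  Let \<open>N = a * x + b\<close> and \<open>N' = (a + b) * x + (n * a + b)\<close> be the remainders of the two consecutive
  powers. The coefficients of \<open>x\<close> decide the comparison of \<open>N'\<close> with \<open>(s + 1) * N\<close> and
  \<open>(s + 2) * N\<close>, for which \<open>s * a \<le> b < (s + 1) * a\<close> is needed. Only if \<open>s * a = b\<close>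
  do the constant terms matter, and there \<open>s ^ 2 \<le> n\<close> settles the comparison.
\<close>

lemma omega_eq_floor_sqrt:
  fixes n s :: nat
  assumes n: "n \<ge> 6" and s: "s ^ 2 \<le> n" "n < (s + 1) ^ 2"
  shows "omega n = int s"
proof -
  define x where "x = n ^ (2 * n)"
  define M where "M = int x ^ 2 - int n"
  have s2: "s \<ge> 2"
  proof (rule ccontr)
    assume "\<not> s \<ge> 2"
    then have "(s + 1) ^ 2 \<le> 2 ^ 2" by (intro power_mono) auto
    with s n show False by simp
  qed
  have sn: "s + 2 \<le> n"
  proof -
    have "2 * s \<le> s ^ 2" using s2 by (simp add: power2_eq_square)
    then show ?thesis using s n by linarith
  qed
  obtain a b where ab:
    "[(int x + 1) ^ (2 * n) = int a * int x + int b] (mod int x ^ 2 - int n)"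
    "real b + real a * sqrt n = (1 + sqrt n) ^ (2 * n)"
    "real b - real a * sqrt n = (1 - sqrt n) ^ (2 * n)"
    "a * (s + 1) + b \<le> (s + 2) ^ (2 * n)"
    using quadratic_power_coefficients[of n s "int x" "2 * n"] s(2) by (auto simp: less_imp_le)
  have btw: "s * a \<le> b" "b < (s + 1) * a"
    using convergent_between[of n s b a] s n ab(2,3) by auto
  have "n * (a * (s + 1) + b) \<le> n * (s + 2) ^ (2 * n)" using ab(4) by simp
  also have "\<dots> \<le> x" unfolding x_def using n s s2 by (intro power_bound)
  finally have nab: "n * (a * (s + 1) + b) \<le> x" .
  have xbig: "n ^ 2 \<le> x" unfolding x_def using n by (intro power_increasing) auto
  have apos: "a > 0" using btw by (cases a) auto
  define N where "N = a * x + b"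
  define N' where "N' = (a + b) * x + (n * a + b)"
  have x36: "36 \<le> x"
    using xbig power_mono[OF n, of 2] by simp
  have nx: "n \<le> x" using xbig n by (simp add: power2_eq_square le_trans[of n "n * n"])
  have n_sum: "n * (a + b) \<le> x"
  proof -
    have "n * (a + b) \<le> n * (a * (s + 1) + b)" by (intro mult_left_mono) auto
    with nab show ?thesis by linarith
  qed
  have "6 * (a + b) \<le> n * (a + b)" using n by (intro mult_right_mono) auto
  then have "6 * (a + b) * x \<le> x * x" using n_sum by (intro mult_right_mono) auto
  moreover have "n * a + b \<le> x"
  proof -
    have "1 * b \<le> n * b" using n by (intro mult_right_mono) auto
    with n_sum show ?thesis unfolding distrib_left by linarith
  qed
  moreover have "36 * x \<le> x * x" using x36 by (rule mult_right_mono) simp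
  \<comment> \<open>Both numbers lie below the modulus, so they are remainders and not merely congruent to them.\<close>
  ultimately have "N' + n < x * x" using x36 nx unfolding N'_def by linarith
  moreover have "N \<le> N'" unfolding N_def N'_def by (intro add_mono mult_right_mono) auto
  moreover have "M = int (x * x) - int n" by (simp add: M_def power2_eq_square)
  ultimately have M: "int N' < M" "int N < M" by linarith+
  have rem: "(int x + 1) ^ (2 * n) mod M = int N"
    using ab(1) M by (simp add: cong_def M_def N_def)
  have "[(int x + 1) ^ (2 * n + 1) = int N * (int x + 1)] (mod M)"
    using cong_scalar_right[OF ab(1), of "int x + 1"] by (simp add: M_def N_def algebra_simps)
  moreover have "[int N * (int x + 1) = int N'] (mod M)"
  proof -
    have "int N * (int x + 1) - int N' = M * int a"
      by (simp add: N_def N'_def M_def algebra_simps power2_eq_square)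
    then show ?thesis by (simp add: cong_iff_dvd_diff)
  qed
  ultimately have rem': "(int x + 1) ^ (2 * n + 1) mod M = int N'"
    using cong_trans M by (fastforce simp: cong_def)
  have lower: "(s + 1) * N \<le> N'"
  proof -
    have "s * b + s * a * x \<le> b * x + n * a"
    proof (cases "s * a = b")
      case True
      have "s * s * a \<le> n * a" using s(1) by (intro mult_right_mono) (auto simp: power2_eq_square)
      with True show ?thesis by (simp add: mult.assoc)
    next
      case False
      with btw have "(s * a + 1) * x \<le> b * x" by (intro mult_right_mono) auto
      moreover have "s * b \<le> n * (a + b)" using sn by (intro mult_mono) auto
      ultimately show ?thesis using n_sum by (simp add: algebra_simps)
    qed
    then show ?thesis by (simp add: N_def N'_def algebra_simps)
  qed
  have upper: "N' < (s + 2) * N"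
  proof -
    have "(b + 1) * x \<le> (s + 1) * a * x" using btw by (intro mult_right_mono) auto
    moreover have "n * a < x + (s + 1) * b"
    proof (cases "b = 0")
      case True
      with btw(1) s2 apos show ?thesis by simp
    next
      case False
      with n n_sum show ?thesis by (simp add: algebra_simps)
    qed
    ultimately show ?thesis by (simp add: N_def N'_def algebra_simps)
  qed
  have "N' div N = s + 1"
    by (rule div_nat_eqI) (use lower upper in \<open>simp_all add: algebra_simps\<close>)
  moreover have "int n ^ (4 * n) - int n = M" and "int n ^ (2 * n) = int x"
    by (simp_all add: M_def x_def flip: power_mult)
  ultimately show ?thesis
    unfolding omega_def
    by (simp only: rem rem' floor_divide_of_int_eq zdiv_int[symmetric] of_nat_add)
qed

section \<open>The larger prime factor\<close>

theorem corollary11: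
  fixes n p q :: nat
  assumes "prime p" and "prime q" and "p < q" and "n = p * q"
  shows "rat_of_nat q =
    rat_of_nat n /
    rat_of_int
      (\<lfloor>rat_of_nat (n ^ (n + n * nat (gamma n mod int n))) /
        rat_of_int ((int n ^ n - 1) * (int n ^ nat (gamma n mod int n) - 1))\<rfloor>
       mod int n)"
proof -
  define s where "s = nat \<lfloor>sqrt n\<rfloor>"
  define g where "g = fact s mod n"
  have p2: "p \<ge> 2" and q3: "q \<ge> 3" using assms prime_ge_2_nat[of p] by auto
  have n6: "n \<ge> 6" using mult_mono[OF p2 q3] assms(4) by simp
  have "real_of_int \<lfloor>sqrt n\<rfloor> = real s" by (simp add: s_def)
  then have "real s \<le> sqrt n" and "sqrt n < real (s + 1)"
    using floor_correct[of "sqrt n"] by simp_all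
  then have "real s ^ 2 \<le> sqrt n ^ 2" and "sqrt n ^ 2 < real (s + 1) ^ 2"
    by (intro power_mono power_strict_mono; simp)+
  then have "real (s ^ 2) \<le> real n" and "real n < real ((s + 1) ^ 2)" by simp_all
  then have s: "s ^ 2 \<le> n" "n < (s + 1) ^ 2"
    by (simp_all only: of_nat_le_iff of_nat_less_iff)
  have "p ^ 2 \<le> n" using assms(3,4) by (simp add: power2_eq_square)
  with s(2) have "p ^ 2 < (s + 1) ^ 2" by linarith
  then have ps: "p \<le> s" using power_less_imp_less_base[of p 2 "s + 1"] by simp
  have "n < q ^ 2" using assms p2 by (simp add: power2_eq_square)
  with s(1) have "s ^ 2 < q ^ 2" by linarith
  then have sq: "s < q" using power_less_imp_less_base by blast
  have "p dvd fact s" and "\<not> q dvd fact s"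
    using ps sq assms by (simp_all add: prime_dvd_fact_iff)
  then have "gcd (p * q) (fact s) = p"
    using assms by (simp add: prime_imp_coprime coprime_commute gcd_mult_left_right_cancel)
  then have gcd: "gcd n g = p"
    by (simp only: g_def assms(4) gcd_red_nat[of "fact s" "p * q", symmetric] gcd.commute)
  have "g < n" using n6 by (simp add: g_def)
  moreover have "g \<noteq> 0"
  proof
    assume "g = 0"
    with gcd have "p * q = p * 1" using assms(4) by simp
    with p2 q3 show False by auto
  qed
  then have "2 \<le> g"
    using gcd p2 gcd_le2_nat[of g n] by linarith
  ultimately have digit: "int n ^ (n + n * g) div ((int n ^ n - 1) * (int n ^ g - 1)) mod int n = int p"
    using gcd_as_digit[of g n] gcd by simp
  have "gamma n = fact s"
    unfolding gamma_def using omega_eq_floor_sqrt[OF n6 s] gamma_of_eq_fact ps p2 by simp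
  then have "gamma n mod int n = int g"
    by (simp add: g_def zmod_int)
  moreover have "rat_of_nat (n ^ k) = rat_of_int (int n ^ k)" for k by simp
  ultimately have "\<lfloor>rat_of_nat (n ^ (n + n * nat (gamma n mod int n))) /
        rat_of_int ((int n ^ n - 1) * (int n ^ nat (gamma n mod int n) - 1))\<rfloor> mod int n = int p"
    by (simp only: nat_int floor_divide_of_int_eq digit)
  then show ?thesis using assms p2 by simp
qed

end
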